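(* Let $n\ge 1$ be an integer, let $a_k=\binom{k+1}{2}$ for $k\ge 1$, and let $R_n(a_k)$ be the $n\times n$ matrix whose $(i,j)$-entry is $1/a_{i+j-1}=1/\binom{i+j}{2}$ for $1\le i,j\le n$. Let $A(n)$ be the $n\times n$ matrix whose $(i,j)$-entry ($1\le i,j\le n$) is $$A_{ij}(n)=\sum_{k=0}^{j-1}(-1)^{i+k+1}\binom{n+i}{n-k}\binom{n+k}{n-i}\binom{i+k-1}{k}\binom{i+k}{k}\frac{i}{2}.$$ Then every $A_{ij}(n)$ is an integer, and $A(n)$ is the inverse of the matrix $R_n(a_k)$. *)

theory Defs
  imports "Jordan_Normal_Form.Matrix"
begin

text \<open>Matrices are taken over the rationals, which contain all entries involved. The entry functions
  below use indices starting at 1; \<^const>\<open>mat\<close> counts rows and columns from 0, hence the shifts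
  by \<^const>\<open>Suc\<close>.\<close>

definition recip_hankel :: "(nat \<Rightarrow> rat) \<Rightarrow> nat \<Rightarrow> rat mat" where
  "recip_hankel a n = mat n n (\<lambda>(i, j). 1 / a (Suc i + Suc j - 1))"

definition triangular_seq :: "nat \<Rightarrow> rat" where
  "triangular_seq k = of_nat ((k + 1) choose 2)"

text \<open>Intended for \<open>1 \<le> i \<le> n\<close> and \<open>1 \<le> j \<le> n\<close>, where no subtraction on \<^typ>\<open>nat\<close> truncates.\<close>

definition inv_entry :: "nat \<Rightarrow> nat \<Rightarrow> nat \<Rightarrow> rat" where
  "inv_entry n i j =
    (\<Sum>k = 0..j - 1. (- 1) ^ (i + k + 1)
       * of_nat ((n + i) choose (n - k)) * of_nat ((n + k) choose (n - i))
       * of_nat ((i + k - 1) choose k) * of_nat ((i + k) choose k)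
       * (of_nat i / 2))"

definition inv_matrix :: "nat \<Rightarrow> rat mat" where
  "inv_matrix n = mat n n (\<lambda>(i, j). inv_entry n (Suc i) (Suc j))"

end

theory Submission
  imports Defs "Jordan_Normal_Form.Determinant"
begin

text \<open>Up to a factor depending only on \<open>n\<close> and \<open>i\<close>, the \<open>k\<close>-th summand of \<open>A\<^sub>i\<^sub>j(n)\<close> is
  \<open>c\<^sub>k = (-1)\<^sup>k (n choose k) (n+k choose k) / (i+k)\<close>. As \<open>1/a\<^sub>j\<^sub>+\<^sub>m\<^sub>-\<^sub>1 = 2/(j+m-1) - 2/(j+m)\<close>, summation
  by parts reduces the \<open>(i,m)\<close>-entry of the product to \<open>2 \<Sum> c\<^sub>k/(m+k) - 2/(n+m) \<Sum> c\<^sub>k\<close>, with \<open>k\<close> from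
  \<open>0\<close> to \<open>n\<close>. Both sums are partial fraction expansions with poles \<open>0, -1, \<dots>, -n\<close>: of
  \<open>\<Prod>\<^sub>l (l-x) / \<Prod>\<^sub>k (x+k)\<close> at \<open>x = i\<close>, where it vanishes, and of the same function with the factor
  \<open>l = i\<close> left out at \<open>x = m\<close>, where it vanishes unless \<open>m = i\<close>.\<close>

section \<open>Lagrange interpolation and partial fractions\<close>

text \<open>A polynomial of degree below \<open>card A\<close> equals its Lagrange interpolant on
  the nodes \<open>A\<close>; dividing by the node product at a point outside \<open>A\<close> gives
  the expansion.\<close>

lemma lagrange_partial_fractions:
  fixes p :: "'a::field poly"
  assumes "finite A" "degree p < card A" "x \<notin> A"
  shows "(\<Sum>a\<in>A. poly p a / ((x - a) * (\<Prod>b\<in>A - {a}. a - b))) = poly p x / (\<Prod>b\<in>A. x - b)"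
proof -
  define L where "L = (\<Sum>a\<in>A. smult (poly p a / (\<Prod>b\<in>A - {a}. a - b)) (\<Prod>b\<in>A - {a}. [:- b, 1:]))"
  have deg: "degree (\<Prod>b\<in>A - {a}. [:- b, 1:]) < card A" if "a \<in> A" for a
  proof -
    have "degree (\<Prod>b\<in>A - {a}. [:- b, 1:]) = card A - 1"
      using that assms(1) by (subst degree_prod_eq_sum_degree) auto
    then show ?thesis
      using assms(2) by simp
  qed
  have "degree L < card A"
    unfolding L_def using assms(2) deg
    by (intro degree_sum_less) (auto intro: le_less_trans[OF degree_smult_le])
  moreover have "poly p c = poly L c" if "c \<in> A" for c
  proof -
    have "poly L c = (\<Sum>a\<in>A. poly p a / (\<Prod>b\<in>A - {a}. a - b) * (\<Prod>b\<in>A - {a}. c - b))"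
      by (simp add: L_def poly_sum poly_prod)
    \<comment> \<open>For a node \<open>a\<close> other than \<open>c\<close> the second product
      contains the factor with \<open>b = c\<close>, which is zero.\<close>
    also have "\<dots> = (\<Sum>a\<in>{c}. poly p a / (\<Prod>b\<in>A - {a}. a - b) * (\<Prod>b\<in>A - {a}. c - b))"
      using that assms(1) by (intro sum.mono_neutral_right) auto
    also have "\<dots> = poly p c"
      using assms(1) by simp
    finally show ?thesis ..
  qed
  ultimately have "p = L"
    using assms(1,2) by (intro poly_eqI_degree[of A])
  then have "poly p x = poly L x"
    by simp
  also have "\<dots> = (\<Sum>a\<in>A. poly p a / (\<Prod>b\<in>A - {a}. a - b) * (\<Prod>b\<in>A - {a}. x - b))"
    by (simp add: L_def poly_sum poly_prod)
  also have "\<dots> = (\<Prod>b\<in>A. x - b) * (\<Sum>a\<in>A. poly p a / ((x - a) * (\<Prod>b\<in>A - {a}. a - b)))"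
    unfolding sum_distrib_left
  proof (intro sum.cong refl)
    fix a assume "a \<in> A"
    moreover have "x - a \<noteq> 0"
      using \<open>a \<in> A\<close> assms(3) by auto
    ultimately show "poly p a / (\<Prod>b\<in>A - {a}. a - b) * (\<Prod>b\<in>A - {a}. x - b)
      = (\<Prod>b\<in>A. x - b) * (poly p a / ((x - a) * (\<Prod>b\<in>A - {a}. a - b)))"
      using assms(1) by (simp add: prod.remove)
  qed
  finally show ?thesis
    using assms(1,3) by (auto simp: field_simps)
qed

text \<open>The factors with l < k give the sign and \<open>fact k\<close>, those with l > k give
  \<open>fact (n - k)\<close>. The induction therefore starts at n = k, where only the former are
  present.\<close>

lemma prod_of_nat_diff:
  assumes "k \<le> n"
  shows "(\<Prod>l\<in>{..n} - {k}. of_nat l - of_nat k :: 'a::field_char_0)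
    = (- 1) ^ k * fact k * fact (n - k)"
  using assms
proof (induction n rule: dec_induct)
  case base
  have "(\<Prod>l\<in>{..k} - {k}. of_nat l - of_nat k :: 'a) = (\<Prod>l<k. of_nat l - of_nat k)"
    by (intro prod.cong) auto
  \<comment> \<open>Reversing the order turns each factor into - (l + 1).\<close>
  also have "\<dots> = (\<Prod>l<k. of_nat (k - Suc l) - of_nat k)"
    by (rule prod.nat_diff_reindex[symmetric])
  also have "\<dots> = (\<Prod>l<k. (- 1) * of_nat (Suc l))"
    by (intro prod.cong) (auto simp: of_nat_diff)
  also have "\<dots> = (\<Prod>l<k. - 1) * (\<Prod>l<k. of_nat (Suc l))"
    by (rule prod.distrib)
  also have "\<dots> = (- 1) ^ k * fact k"
    by (simp add: fact_prod_Suc lessThan_atLeast0)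
  finally show ?case
    by simp
next
  case (step n)
  then have "{..Suc n} - {k} = insert (Suc n) ({..n} - {k})"
    by auto
  then have "(\<Prod>l\<in>{..Suc n} - {k}. of_nat l - of_nat k :: 'a)
      = of_nat (Suc n - k) * ((- 1) ^ k * fact k * fact (n - k))"
    using step by (simp add: of_nat_diff)
  then show ?case
    using step.hyps by (simp add: Suc_diff_le algebra_simps)
qed

lemma prod_of_nat_add: "(\<Prod>l\<in>{1..n}. of_nat l + of_nat k :: 'a::field_char_0) = fact (n + k) / fact k"
  by (induction n) (auto simp: algebra_simps)

text \<open>Interpolation at the nodes 0, -1, ..., -n of the polynomial \<open>p\<close> with p(y) =
  \<Prod>(l - y), whose value at -k is \<Prod>(l + k). The bound on \<open>card S\<close> keeps its
  degree below the number n + 1 of nodes.\<close>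

lemma partial_fractions_nonpos_ints:
  fixes x :: "'a::field_char_0"
  assumes "finite S" "card S \<le> n" "\<And>k. k \<le> n \<Longrightarrow> x + of_nat k \<noteq> 0"
  shows "(\<Sum>k\<le>n. (\<Prod>l\<in>S. of_nat l + of_nat k) / ((x + of_nat k) * ((- 1) ^ k * fact k * fact (n - k))))
    = (\<Prod>l\<in>S. of_nat l - x) / (\<Prod>k\<le>n. x + of_nat k)"
proof -
  define A where "A = (\<lambda>k. - of_nat k :: 'a) ` {..n}"
  define p where "p = (\<Prod>l\<in>S. [:of_nat l, - 1 :: 'a:])"
  have inj: "inj_on (\<lambda>k. - of_nat k :: 'a) B" for B
    by (auto simp: inj_on_def)
  have p: "poly p y = (\<Prod>l\<in>S. of_nat l - y)" for y
    by (simp add: p_def poly_prod)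
  have "degree p \<le> n"
    unfolding p_def using assms(1,2) by (subst degree_prod_eq_sum_degree) auto
  moreover have "card A = Suc n"
    unfolding A_def by (simp add: card_image inj)
  moreover have "x \<notin> A"
    using assms(3) by (fastforce simp: A_def)
  ultimately have "(\<Sum>a\<in>A. poly p a / ((x - a) * (\<Prod>b\<in>A - {a}. a - b)))
      = poly p x / (\<Prod>b\<in>A. x - b)"
    by (intro lagrange_partial_fractions) (auto simp: A_def)
  moreover have "(\<Prod>b\<in>A. x - b) = (\<Prod>k\<le>n. x + of_nat k)"
    unfolding A_def by (simp add: prod.reindex[OF inj])
  moreover have "(\<Prod>b\<in>A - {- of_nat k}. - of_nat k - b) = (- 1) ^ k * fact k * fact (n - k)"
    if "k \<le> n" for k
  proof -
    have "A - {- of_nat k} = (\<lambda>k. - of_nat k :: 'a) ` ({..n} - {k})"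
      by (auto simp: A_def)
    then show ?thesis
      by (simp add: prod.reindex[OF inj] prod_of_nat_diff[OF that, symmetric])
  qed
  ultimately show ?thesis
    by (simp add: A_def sum.reindex[OF inj] p)
qed

section \<open>Integrality of the entries\<close>

lemma even_product_binomials: "even ((n + k choose (i + k)) * (n + i choose (i + k)) * (i + k))"
proof (cases "i + k")
  case (Suc m)
  have *: "Suc m * (N choose Suc m) = N * (N - 1 choose m)" for N
    by (cases N) (simp_all only: Suc_times_binomial diff_Suc_1 binomial_0_Suc mult_0 mult_0_right)
  \<comment> \<open>If \<open>i + k\<close> is odd, one of \<open>n + k\<close>, \<open>n + i\<close> is even, and then so is its binomial coefficient.\<close>
  show ?thesis
    using *[of "n + k"] *[of "n + i"] Suc by (metis even_add even_mult_iff)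
qed auto

text \<open>Symmetry gives the first two binomials the lower index i + k, and absorption trades the
  factor i for i + k. The even product then appears as a factor and absorbs the denominator
  2.\<close>

lemma inv_entry_summand_Ints:
  assumes "1 \<le> i" "i \<le> n" "k \<le> n"
  shows "(- 1) ^ (i + k + 1) * of_nat ((n + i) choose (n - k)) * of_nat ((n + k) choose (n - i))
       * of_nat ((i + k - 1) choose k) * of_nat ((i + k) choose k) * (of_nat i / 2) \<in> (\<int> :: rat set)"
    (is "?t \<in> _")
proof -
  have 1: "(n + i choose (n - k)) = (n + i choose (i + k))"
    using assms by (subst binomial_symmetric) (auto intro: arg_cong)
  have 2: "(n + k choose (n - i)) = (n + k choose (i + k))"
    using assms by (subst binomial_symmetric) (auto intro: arg_cong)
  have 3: "(i + k choose k) * i = (i + k) * (i + k - 1 choose k)"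
    using binomial_absorb_comp[of "i + k" k] by (simp add: mult.commute)
  have "even ((n + i choose (n - k)) * (n + k choose (n - i)) * (i + k - 1 choose k)
      * ((i + k choose k) * i))"
    unfolding 1 2 3 using even_product_binomials[of n k i] by auto
  then obtain m where "(n + i choose (n - k)) * (n + k choose (n - i)) * (i + k - 1 choose k)
      * ((i + k choose k) * i) = 2 * m"
    by (elim evenE)
  then have m: "of_nat (n + i choose (n - k)) * of_nat (n + k choose (n - i))
      * of_nat (i + k - 1 choose k) * (of_nat (i + k choose k) * of_nat i) = (2 * of_nat m :: rat)"
    by (metis of_nat_mult of_nat_numeral)
  have "?t = (- 1) ^ (i + k + 1) * (of_nat (n + i choose (n - k)) * of_nat (n + k choose (n - i))
      * of_nat (i + k - 1 choose k) * (of_nat (i + k choose k) * of_nat i)) / (2 :: rat)"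
    by (simp only: mult.assoc times_divide_eq_right)
  also have "\<dots> = (- 1) ^ (i + k + 1) * of_nat m"
    unfolding m by simp
  finally have t: "?t = (- 1) ^ (i + k + 1) * of_nat m" .
  show ?thesis
    unfolding t by (intro Ints_mult Ints_power) auto
qed

lemma inv_entry_Ints:
  assumes "i \<in> {1..n}" "j \<in> {1..n}"
  shows "inv_entry n i j \<in> \<int>"
  unfolding inv_entry_def using assms by (intro Ints_sum inv_entry_summand_Ints) auto

section \<open>Entries of the product of the two matrices\<close>

text \<open>Writing all binomials as factorials separates a factor free of k from a summand of
  \<open>partial_fractions_nonpos_ints\<close> with S = {1..n} and x = i.\<close>

lemma inv_entry_summand_eq:
  assumes "1 \<le> i" "i \<le> n" "k \<le> n"
  shows "(- 1) ^ (i + k + 1) * of_nat ((n + i) choose (n - k)) * of_nat ((n + k) choose (n - i))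
       * of_nat ((i + k - 1) choose k) * of_nat ((i + k) choose k) * (of_nat i / 2)
    = ((- 1) ^ (i + 1) * fact (n + i) / (2 * fact (n - i) * fact (i - 1) ^ 2)) *
      ((\<Prod>l\<in>{1..n}. of_nat l + of_nat k)
        / ((of_nat i + of_nat k) * ((- 1) ^ k * fact k * fact (n - k))) :: rat)"
proof -
  obtain j where i: "i = Suc j"
    using assms(1) by (cases i) auto
  have *: "n + i - (n - k) = Suc (j + k)" "n + k - (n - i) = Suc (j + k)"
    using assms i by auto
  \<comment> \<open>Here u and v are the signs (-1)^k and (-1)^i, s = j + k + 1, t = j + 1, and a,
    b, c, d, e, f, g are the factorials of n + i, n + k, n - k, n - i, j + k, k, j. Since u is its
    own inverse, it may move to the denominator.\<close>
  have alg: "v * u * (- 1) * (a / (c * (s * e))) * (b / (d * (s * e))) * (e / (f * g))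
        * (s * e / (f * (t * g))) * (t / 2)
      = v * (- 1) * a / (2 * d * g ^ 2) * (b / f / (s * (u * f * c)))"
    if "u * u = 1" "c \<noteq> 0" "d \<noteq> 0" "e \<noteq> 0" "f \<noteq> 0" "g \<noteq> 0" "s \<noteq> 0" "t \<noteq> 0"
    for a b c d e f g s t u v :: rat
  proof -
    have "u = 1 \<or> u = - 1"
      using that(1) by (simp add: square_eq_1_iff)
    then show ?thesis
      using that(2-) by (auto simp: field_simps power2_eq_square)
  qed
  have 0: "(- 1) ^ k * (- 1 :: rat) ^ k = 1"
    by (simp flip: power_mult_distrib)
  have 1: "of_nat ((i + k - 1) choose k) = (fact (j + k) / (fact k * fact j) :: rat)"
    using binomial_fact[of k "j + k", where ?'a = rat] i by simp
  have 2: "of_nat ((i + k) choose k)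
      = (of_nat (Suc (j + k)) * fact (j + k) / (fact k * (of_nat (Suc j) * fact j)) :: rat)"
    using binomial_fact[of k "Suc j + k", where ?'a = rat] i by (simp del: of_nat_Suc)
  have 3: "of_nat ((n + i) choose (n - k))
      = (fact (n + i) / (fact (n - k) * (of_nat (Suc (j + k)) * fact (j + k))) :: rat)"
    using binomial_fact[of "n - k" "n + i", where ?'a = rat] * by (simp del: of_nat_Suc)
  have 4: "of_nat ((n + k) choose (n - i))
      = (fact (n + k) / (fact (n - i) * (of_nat (Suc (j + k)) * fact (j + k))) :: rat)"
    using binomial_fact[of "n - i" "n + k", where ?'a = rat] * by (simp del: of_nat_Suc)
  have 5: "of_nat i + of_nat k = (of_nat (Suc (j + k)) :: rat)" "of_nat i = (of_nat (Suc j) :: rat)"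
    "i - 1 = j"
    using i by simp_all
  have 6: "(- 1) ^ (i + k + 1) = (- 1) ^ i * (- 1) ^ k * (- 1 :: rat)"
    "(- 1) ^ (i + 1) = (- 1) ^ i * (- 1 :: rat)"
    by (simp_all add: power_add)
  show ?thesis
    unfolding prod_of_nat_add 1 2 3 4 5(1) 6
    unfolding 5(2,3)
    by (rule alg[OF 0]) (simp_all del: of_nat_Suc)
qed

lemma sum_triangular_telescope:
  fixes c :: "nat \<Rightarrow> rat"
  assumes "1 \<le> m"
  shows "(\<Sum>j\<in>{1..n}. (\<Sum>k = 0..j - 1. c k) * (1 / triangular_seq (j + m - 1)))
    = 2 * ((\<Sum>k\<le>n. c k / (of_nat m + of_nat k)) - (\<Sum>k\<le>n. c k) / of_nat (n + m))"
proof (induction n)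
  case 0
  then show ?case by simp
next
  case (Suc n)
  have tri: "1 / triangular_seq (Suc n + m - 1) = 2 / of_nat (n + m) - 2 / of_nat (Suc n + m)"
  proof -
    have "2 * (n + m + 1 choose 2) = (n + m) * (Suc n + m)"
      by (simp add: choose_two)
    then have "2 * triangular_seq (n + m) = of_nat (n + m) * of_nat (Suc n + m)"
      unfolding triangular_seq_def by (metis of_nat_mult of_nat_numeral)
    then have "triangular_seq (n + m) = of_nat (n + m) * of_nat (Suc n + m) / 2"
      by simp
    moreover have "1 / (a * b / 2) = 2 / a - 2 / b" if "a \<noteq> 0" "b \<noteq> 0" "b = a + 1" for a b :: rat
      using that by (simp add: field_simps)
    moreover have "of_nat (n + m) \<noteq> (0 :: rat)" "of_nat (Suc n + m) \<noteq> (0 :: rat)"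
      "of_nat (Suc n + m) = of_nat (n + m) + (1 :: rat)" "Suc n + m - 1 = n + m"
      using assms by (simp_all del: of_nat_add of_nat_Suc add: of_nat_Suc[of "n + m"])
    ultimately show ?thesis
      by metis
  qed
  have "(\<Sum>j\<in>{1..Suc n}. (\<Sum>k = 0..j - 1. c k) * (1 / triangular_seq (j + m - 1)))
      = 2 * ((\<Sum>k\<le>n. c k / (of_nat m + of_nat k)) - (\<Sum>k\<le>n. c k) / of_nat (n + m))
        + (\<Sum>k\<le>n. c k) * (2 / of_nat (n + m) - 2 / of_nat (Suc n + m))"
    unfolding tri[symmetric] using Suc.IH by (simp add: atMost_atLeast0)
  \<comment> \<open>By this equality the new term \<open>c (Suc n)\<close> has the same denominator
    in both sums on the right and cancels.\<close>
  moreover have "of_nat m + of_nat (Suc n) = (of_nat (Suc n + m) :: rat)"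
    by simp
  ultimately show ?case
    by (simp only: sum.atMost_Suc) (simp add: add_divide_distrib algebra_simps del: of_nat_Suc of_nat_add)
qed


text \<open>The factor - i belonging to l = 0 is divided out of
  \<open>prod_of_nat_diff\<close>.\<close>

lemma prod_of_nat_diff_remove_0:
  assumes "1 \<le> i" "i \<le> n"
  shows "(\<Prod>l\<in>{1..n} - {i}. of_nat l - of_nat i :: 'a::field_char_0)
    = (- 1) ^ (i + 1) * fact (i - 1) * fact (n - i)"
proof -
  have "{..n} - {i} = insert 0 ({1..n} - {i})"
    using assms by auto
  then have *: "- of_nat i * (\<Prod>l\<in>{1..n} - {i}. of_nat l - of_nat i :: 'a)
      = (- 1) ^ i * fact i * fact (n - i)"
    using prod_of_nat_diff[OF assms(2), where ?'a = 'a] by simp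
  have "of_nat i * (\<Prod>l\<in>{1..n} - {i}. of_nat l - of_nat i :: 'a)
      = - ((- 1) ^ i * fact i * fact (n - i))"
    unfolding *[symmetric] by simp
  moreover have "fact i = (of_nat i * fact (i - 1) :: 'a)"
    using assms(1) by (simp add: fact_reduce)
  ultimately have "of_nat i * (\<Prod>l\<in>{1..n} - {i}. of_nat l - of_nat i :: 'a)
      = of_nat i * ((- 1) ^ (i + 1) * fact (i - 1) * fact (n - i))"
    by (simp add: algebra_simps)
  then show ?thesis
    using assms(1) by (subst (asm) mult_left_cancel) auto
qed

lemma prod_of_nat_add_atMost:
  assumes "1 \<le> i"
  shows "(\<Prod>k\<le>n. of_nat i + of_nat k :: 'a::field_char_0) = fact (n + i) / fact (i - 1)"
proof -
  have "{..n} = insert 0 {1..n}"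
    by auto
  then have "(\<Prod>k\<le>n. of_nat i + of_nat k :: 'a) = of_nat i * (fact (n + i) / fact i)"
    using prod_of_nat_add[of i n, where ?'a = 'a] by (simp add: add.commute)
  also have "\<dots> = fact (n + i) / fact (i - 1)"
    using assms by (simp add: fact_reduce)
  finally show ?thesis .
qed

lemma sum_inv_entry_recip:
  assumes i: "1 \<le> i" "i \<le> n" and m: "1 \<le> m" "m \<le> n"
  shows "(\<Sum>j\<in>{1..n}. inv_entry n i j * (1 / triangular_seq (j + m - 1))) = (if i = m then 1 else 0)"
proof -
  \<comment> \<open>\<open>K\<close> is the factor free of k from
    \<open>inv_entry_summand_eq\<close>; \<open>D k\<close> is the product of the differences
    between the pole -k and the other poles.\<close>
  define K :: rat where "K = (- 1) ^ (i + 1) * fact (n + i) / (2 * fact (n - i) * fact (i - 1) ^ 2)"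
  define D :: "nat \<Rightarrow> rat" where "D k = (- 1) ^ k * fact k * fact (n - k)" for k
  define c :: "nat \<Rightarrow> rat" where
    "c k = K * ((\<Prod>l\<in>{1..n}. of_nat l + of_nat k) / ((of_nat i + of_nat k) * D k))" for k
  have pos: "of_nat x + of_nat k \<noteq> (0 :: rat)" if "1 \<le> x" for x k
    using that by (simp flip: of_nat_add)
  have "inv_entry n i j = (\<Sum>k = 0..j - 1. c k)" if "j \<in> {1..n}" for j
    unfolding inv_entry_def c_def K_def D_def using that i
    by (intro sum.cong inv_entry_summand_eq) auto
  then have "(\<Sum>j\<in>{1..n}. inv_entry n i j * (1 / triangular_seq (j + m - 1)))
      = 2 * ((\<Sum>k\<le>n. c k / (of_nat m + of_nat k)) - (\<Sum>k\<le>n. c k) / of_nat (n + m))"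
    using sum_triangular_telescope[OF m(1), of c n] by simp
  also have "(\<Sum>k\<le>n. c k) = 0"
  proof -
    \<comment> \<open>The numerator of the expansion at x = i has the zero factor l = i.\<close>
    have "(\<Prod>l\<in>{1..n}. of_nat l - of_nat i :: rat) = 0"
      using i by auto
    then show ?thesis
      unfolding c_def D_def sum_distrib_left[symmetric] using i
      by (subst partial_fractions_nonpos_ints) (auto simp: pos)
  qed
  also have "(\<Sum>k\<le>n. c k / (of_nat m + of_nat k))
      = K * (\<Sum>k\<le>n. (\<Prod>l\<in>{1..n} - {i}. of_nat l + of_nat k) / ((of_nat m + of_nat k) * D k))"
    unfolding sum_distrib_left
  proof (intro sum.cong refl)
    fix k
    \<comment> \<open>The factor l = i cancels the denominator i + k of \<open>c k\<close>, so m + k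
      is the only linear denominator left.\<close>
    have "(\<Prod>l\<in>{1..n}. of_nat l + of_nat k :: rat)
        = (of_nat i + of_nat k) * (\<Prod>l\<in>{1..n} - {i}. of_nat l + of_nat k)"
      using i by (subst prod.remove[of _ i]) auto
    then show "c k / (of_nat m + of_nat k)
        = K * ((\<Prod>l\<in>{1..n} - {i}. of_nat l + of_nat k) / ((of_nat m + of_nat k) * D k))"
      using pos[OF i(1), of k] by (simp add: c_def)
  qed
  also have "(\<Sum>k\<le>n. (\<Prod>l\<in>{1..n} - {i}. of_nat l + of_nat k) / ((of_nat m + of_nat k) * D k))
      = (\<Prod>l\<in>{1..n} - {i}. of_nat l - of_nat m) / (\<Prod>k\<le>n. of_nat m + of_nat k)"
    unfolding D_def using m by (intro partial_fractions_nonpos_ints) (auto simp: pos card_Diff_singleton_if)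
  also have "2 * (K * \<dots> - 0 / of_nat (n + m)) = (if i = m then 1 else 0)"
  proof (cases "i = m")
    case True
    have "((- 1) ^ (i + 1)) * ((- 1 :: rat) ^ (i + 1)) = 1"
      by (simp flip: power_mult_distrib)
    then have "2 * K * ((- 1) ^ (i + 1) * fact (i - 1) * fact (n - i) / (fact (n + i) / fact (i - 1))) = 1"
      unfolding K_def by (simp add: field_simps power2_eq_square)
    then show ?thesis
      unfolding True[symmetric] prod_of_nat_diff_remove_0[OF i] prod_of_nat_add_atMost[OF i(1)]
      by (simp only: mult.assoc div_0 diff_zero if_True simp_thms)
  next
    case False
    \<comment> \<open>As m differs from i, the factor l = m is still present.\<close>
    then have "(\<Prod>l\<in>{1..n} - {i}. of_nat l - of_nat m :: rat) = 0"
      using m by auto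
    then show ?thesis
      using False by simp
  qed
  finally show ?thesis .
qed

section \<open>Passage to matrices\<close>

lemma inv_matrix_mult_recip_hankel: "inv_matrix n * recip_hankel triangular_seq n = 1\<^sub>m n"
proof (intro eq_matI)
  fix i m assume "i < dim_row (1\<^sub>m n :: rat mat)" "m < dim_col (1\<^sub>m n :: rat mat)"
  then have im: "i < n" "m < n"
    by auto
  then have "(inv_matrix n * recip_hankel triangular_seq n) $$ (i, m)
      = (\<Sum>j = 0..<n. inv_entry n (Suc i) (Suc j) * (1 / triangular_seq (Suc j + Suc m - 1)))"
    by (simp add: inv_matrix_def recip_hankel_def scalar_prod_def)
  also have "\<dots> = (\<Sum>j\<in>{1..n}. inv_entry n (Suc i) j * (1 / triangular_seq (j + Suc m - 1)))"
    by (rule sum.reindex_bij_witness[of _ "\<lambda>j. j - 1" Suc]) auto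
  also have "\<dots> = (1\<^sub>m n) $$ (i, m)"
    using im by (subst sum_inv_entry_recip) auto
  finally show "(inv_matrix n * recip_hankel triangular_seq n) $$ (i, m) = (1\<^sub>m n) $$ (i, m)" .
qed (auto simp: inv_matrix_def recip_hankel_def)

theorem theorem5p1:
  fixes n :: nat
  assumes "n \<ge> 1"
  shows "(\<forall>i\<in>{1..n}. \<forall>j\<in>{1..n}. inv_entry n i j \<in> \<int>)
    \<and> inverts_mat (recip_hankel triangular_seq n) (inv_matrix n)
    \<and> inverts_mat (inv_matrix n) (recip_hankel triangular_seq n)"
proof -
  have carrier: "inv_matrix n \<in> carrier_mat n n" "recip_hankel triangular_seq n \<in> carrier_mat n n"
    by (auto simp: inv_matrix_def recip_hankel_def)
  \<comment> \<open>For square matrices over a field, a left inverse is also a right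
    inverse.\<close>
  from mat_mult_left_right_inverse[OF carrier inv_matrix_mult_recip_hankel]
  show ?thesis
    using carrier inv_entry_Ints by (auto simp: inverts_mat_def inv_matrix_mult_recip_hankel)
qed

end
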